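(* For any positive integers $l$ and $t$, and every $n$, there is a packing of $Q_n$ by pairwise vertex-disjoint induced copies of $(P_l)^t$ for which at most $O(n^{t-1})$ vertices of $Q_n$ are uncovered (the implied constant depending only on $l$ and $t$).
   Context: $Q_n$ is the $n$-dimensional hypercube on $\{0,1\}^n$. $P_l$ is the path on $l$ vertices. For graphs $G_1,G_2$ the Cartesian product $G_1\times G_2$ has vertex set $V(G_1)\times V(G_2)$, with $(u_1,u_2)\sim(v_1,v_2)$ iff either $u_1=v_1$ and $u_2v_2\in E(G_2)$, or $u_2=v_2$ and $u_1v_1\in E(G_1)$; $G^t$ is the product of $t$ copies of $G$. An induced copy of a graph $F$ in $Q_n$ is an induced subgraph of $Q_n$ isomorphic to $F$. *)

theory Defs
  imports
    Complex_Main
    "Graph_Theory.Pair_Digraph"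
    "Graph_Theory.Digraph_Isomorphism"
begin

text \<open>
  A simple graph is a \<open>pair_graph\<close> of the AFP entry \<open>Graph_Theory\<close>: a finite loop-free digraph
  whose arc relation is symmetric, an edge \<open>uv\<close> being the two arcs \<open>(u, v)\<close> and \<open>(v, u)\<close>.
\<close>

definition hypercube :: "nat \<Rightarrow> bool list pair_pre_digraph" where
  "hypercube n =
    \<lparr> pverts = {x. length x = n},
      parcs = {(x, y). length x = n \<and> length y = n \<and> card {i. i < n \<and> x ! i \<noteq> y ! i} = 1} \<rparr>"

text \<open>The parameter of \<open>path_graph\<close> counts vertices, not edges.\<close>

definition path_graph :: "nat \<Rightarrow> nat pair_pre_digraph" where
  "path_graph l =
    \<lparr> pverts = {..<l},
      parcs = {(i, j). i < l \<and> j < l \<and> (j = Suc i \<or> i = Suc j)} \<rparr>"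

definition cart_prod ::
  "'a pair_pre_digraph \<Rightarrow> 'b pair_pre_digraph \<Rightarrow> ('a \<times> 'b) pair_pre_digraph" where
  "cart_prod G H =
    \<lparr> pverts = pverts G \<times> pverts H,
      parcs = {((u1, u2), (v1, v2)).
        u1 = v1 \<and> u1 \<in> pverts G \<and> (u2, v2) \<in> parcs H \<or>
        u2 = v2 \<and> u2 \<in> pverts H \<and> (u1, v1) \<in> parcs G} \<rparr>"

text \<open>
  The vertex type of a \<open>t\<close>-fold product would depend on \<open>t\<close>, so the nested pairs are flattened to
  lists of length \<open>t\<close> by relabelling along the injection \<open>(u, us) \<mapsto> u # us\<close>. The empty product
  is the graph with one vertex.
\<close>

primrec cart_power :: "'a pair_pre_digraph \<Rightarrow> nat \<Rightarrow> 'a list pair_pre_digraph" where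
  "cart_power G 0 = \<lparr> pverts = {[]}, parcs = {} \<rparr>"
| "cart_power G (Suc t) =
    (let P = cart_prod G (cart_power G t); f = (\<lambda>(u, us). u # us)
     in \<lparr> pverts = f ` pverts P, parcs = map_prod f f ` parcs P \<rparr>)"

definition induced_copy :: "'b pair_pre_digraph \<Rightarrow> 'a pair_pre_digraph \<Rightarrow> 'a pair_pre_digraph \<Rightarrow> bool"
  where "induced_copy F G H \<longleftrightarrow>
    induced_subgraph (with_proj H) (with_proj G) \<and> digraph_iso (with_proj F) (with_proj H)"

definition induced_packing ::
  "'b pair_pre_digraph \<Rightarrow> 'a pair_pre_digraph \<Rightarrow> 'a pair_pre_digraph set \<Rightarrow> bool" where
  "induced_packing F G \<P> \<longleftrightarrow>
    (\<forall>H\<in>\<P>. induced_copy F G H) \<and> pairwise (\<lambda>H K. disjnt (pverts H) (pverts K)) \<P>"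

definition uncovered :: "'a pair_pre_digraph \<Rightarrow> 'a pair_pre_digraph set \<Rightarrow> 'a set" where
  "uncovered G \<P> = pverts G - (\<Union>H\<in>\<P>. pverts H)"

lemma pair_graphI:
  assumes "finite (pverts G)" "sym (parcs G)" "irrefl (parcs G)"
    and "parcs G \<subseteq> pverts G \<times> pverts G"
  shows "pair_graph G"
proof -
  have "finite (parcs G)"
    using assms(1,4) by (meson finite_SigmaI finite_subset)
  then show ?thesis
    using assms by unfold_locales (auto simp: symmetric_def irrefl_def)
qed

lemma pair_graph_hypercube: "pair_graph (hypercube n)"
proof (rule pair_graphI)
  show "finite (pverts (hypercube n))"
    using finite_lists_length_eq[of "UNIV :: bool set" n] by (simp add: hypercube_def)
  have "{i. i < n \<and> x ! i \<noteq> y ! i} = {i. i < n \<and> y ! i \<noteq> x ! i}" for x y :: "bool list"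
    by auto
  then show "sym (parcs (hypercube n))"
    by (simp add: hypercube_def sym_def)
qed (auto simp: hypercube_def irrefl_def)

lemma pair_graph_path_graph: "pair_graph (path_graph l)"
  by (rule pair_graphI) (auto simp: path_graph_def sym_def irrefl_def)

lemma pair_graph_cart_prod:
  assumes "pair_graph G" "pair_graph H"
  shows "pair_graph (cart_prod G H)"
proof -
  interpret G: pair_graph G by fact
  interpret H: pair_graph H by fact
  have sG: "(v, u) \<in> parcs G" if "(u, v) \<in> parcs G" for u v
    using G.pair_sym_arcs that by (auto simp: symmetric_def dest: symD)
  have sH: "(v, u) \<in> parcs H" if "(u, v) \<in> parcs H" for u v
    using H.pair_sym_arcs that by (auto simp: symmetric_def dest: symD)
  have lG: "(u, u) \<notin> parcs G" for u
    using G.pair_no_loops[of "(u, u)"] by auto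
  have lH: "(u, u) \<notin> parcs H" for u
    using H.pair_no_loops[of "(u, u)"] by auto
  show ?thesis
  proof (rule pair_graphI)
    show "finite (pverts (cart_prod G H))"
      using G.pair_finite_verts H.pair_finite_verts by (simp add: cart_prod_def)
    show "sym (parcs (cart_prod G H))"
      by (rule symI) (auto simp: cart_prod_def intro: sG sH)
    show "irrefl (parcs (cart_prod G H))"
      by (auto simp: cart_prod_def irrefl_def lG lH)
    show "parcs (cart_prod G H) \<subseteq> pverts (cart_prod G H) \<times> pverts (cart_prod G H)"
      by (auto simp: cart_prod_def dest: G.in_arcsD1 G.in_arcsD2 H.in_arcsD1 H.in_arcsD2)
  qed
qed

lemma pair_graph_cart_power:
  assumes "pair_graph G"
  shows "pair_graph (cart_power G t)"
proof (induction t)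
  case 0
  show ?case by (rule pair_graphI) (auto simp: sym_def irrefl_def)
next
  case (Suc t)
  define P where "P = cart_prod G (cart_power G t)"
  define f :: "'a \<times> 'a list \<Rightarrow> 'a list" where "f = (\<lambda>(u, us). u # us)"
  interpret P: pair_graph P
    unfolding P_def using assms Suc by (rule pair_graph_cart_prod)
  have f: "f p = f q \<longleftrightarrow> p = q" for p q
    by (cases p, cases q) (simp add: f_def)
  have eq: "cart_power G (Suc t) = \<lparr> pverts = f ` pverts P, parcs = map_prod f f ` parcs P \<rparr>"
    by (simp add: P_def f_def Let_def)
  have s: "(q, p) \<in> parcs P" if "(p, q) \<in> parcs P" for p q
    using P.pair_sym_arcs that by (auto simp: symmetric_def dest: symD)
  have l: "(p, p) \<notin> parcs P" for p
    using P.pair_no_loops[of "(p, p)"] by auto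
  show ?case
    unfolding eq
  proof (rule pair_graphI, goal_cases)
    case 1
    show ?case using P.pair_finite_verts by simp
  next
    case 2
    show ?case
    proof (rule symI)
      fix x y
      assume "(x, y) \<in> parcs \<lparr> pverts = f ` pverts P, parcs = map_prod f f ` parcs P \<rparr>"
      then obtain p q where "(p, q) \<in> parcs P" "x = f p" "y = f q" by auto
      then show "(y, x) \<in> parcs \<lparr> pverts = f ` pverts P, parcs = map_prod f f ` parcs P \<rparr>"
        using s[of p q] by (auto intro: rev_image_eqI)
    qed
  next
    case 3
    show ?case by (auto simp: irrefl_def f l)
  next
    case 4
    show ?case by (auto dest: P.in_arcsD1 P.in_arcsD2)
  qed
qed

end

theory Submission
  imports Defs "HOL-Number_Theory.Cong"
begin

text \<open>
  Let \<open>W\<close> be an induced path on \<open>s = q l + r\<close> vertices with \<open>r \<le> q\<close>. In the ladder \<open>W \<times> Q\<^sub>1\<close>, an induced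
  path that changes sides \<open>r\<close> times leaves complementary segments whose sizes are multiples of \<open>l\<close>. Its
  own end can be cut off in blocks of \<open>l\<close>, so up to copies of \<open>P\<^sub>l\<close> the ladder is again an induced path
  of bounded size: every further factor \<open>Q\<^sub>1\<close> costs boundedly many copies of \<open>P\<^sub>l\<close>, and the remainder
  never grows. Each such \<open>P\<^sub>l\<close>, multiplied by a packing of a smaller cube by copies of \<open>(P\<^sub>l)\<^sup>t\<close>, is packed by
  copies of \<open>(P\<^sub>l)\<^bsup>t+1\<^esup>\<close>. Hence the uncovered counts satisfy \<open>u\<^bsub>t+1\<^esub>(n) \<le> K (1 + n u\<^sub>t(n))\<close> with \<open>u\<^sub>0 = 0\<close>.
  The recursion starts from a partition of a fixed cube into induced paths with at least \<open>l\<^sup>2\<close> vertices.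
\<close>

section \<open>Words of the cube, packings and exact tilings by induced paths\<close>

definition cube_adj :: "bool list \<Rightarrow> bool list \<Rightarrow> bool" where
  "cube_adj x y \<longleftrightarrow> length x = length y \<and> card {i. i < length x \<and> x ! i \<noteq> y ! i} = 1"

definition cube :: "nat \<Rightarrow> bool list set" where
  "cube n = {x. length x = n}"

definition append_sets :: "'a list set \<Rightarrow> 'a list set \<Rightarrow> 'a list set"  (infixr "\<odot>" 75) where
  "A \<odot> B = {x @ y | x y. x \<in> A \<and> y \<in> B}"

definition cube_embedding :: "'b pair_pre_digraph \<Rightarrow> nat \<Rightarrow> ('b \<Rightarrow> bool list) \<Rightarrow> bool" where
  "cube_embedding F n \<phi> \<longleftrightarrow> \<phi> ` pverts F \<subseteq> cube n \<and> inj_on \<phi> (pverts F) \<and>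
    (\<forall>u\<in>pverts F. \<forall>v\<in>pverts F. cube_adj (\<phi> u) (\<phi> v) \<longleftrightarrow> (u, v) \<in> parcs F)"

text \<open>An induced copy is determined by its vertex set, so a packing is kept as a family of
  vertex sets. Allowing any set \<open>A\<close> lets disjoint pieces of the cube be packed
  separately, with the bounds \<open>k\<close> adding up.\<close>

definition packs :: "'b pair_pre_digraph \<Rightarrow> nat \<Rightarrow> bool list set \<Rightarrow> nat \<Rightarrow> bool" where
  "packs F n A k \<longleftrightarrow> (\<exists>\<C>. (\<forall>X\<in>\<C>. \<exists>\<phi>. cube_embedding F n \<phi> \<and> X = \<phi> ` pverts F) \<and>
    pairwise disjnt \<C> \<and> \<Union>\<C> \<subseteq> A \<and> card (A - \<Union>\<C>) \<le> k)"

definition induced_path :: "nat \<Rightarrow> nat \<Rightarrow> (nat \<Rightarrow> bool list) \<Rightarrow> bool" where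
  "induced_path n s p \<longleftrightarrow> (\<forall>i<s. length (p i) = n) \<and>
    (\<forall>i<s. \<forall>j<s. (p i = p j \<longleftrightarrow> i = j) \<and> (cube_adj (p i) (p j) \<longleftrightarrow> j = Suc i \<or> i = Suc j))"

text \<open>An exact partition, with nothing left over. The inductive form lets properties of a
  partition be proved by adding one path at a time, without naming the family of paths.\<close>

inductive path_tiled :: "nat \<Rightarrow> nat \<Rightarrow> bool list set \<Rightarrow> bool" for n s where
  empty: "path_tiled n s {}"
| insert: "path_tiled n s A \<Longrightarrow> induced_path n s p \<Longrightarrow> A \<inter> p ` {..<s} = {}
    \<Longrightarrow> path_tiled n s (A \<union> p ` {..<s})"

subsection \<open>Adjacency in the cube\<close>

lemma not_cube_adj_refl [simp]: "\<not> cube_adj x x"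
  by (simp add: cube_adj_def)

lemma cube_adj_sym: "cube_adj x y \<longleftrightarrow> cube_adj y x"
proof -
  define d where "d x y = card {i. i < length x \<and> x ! i \<noteq> y ! i}" for x y :: "bool list"
  have "d x y = d y x" if "length x = length y"
    unfolding d_def using that by (intro arg_cong[where f = card]) auto
  then show ?thesis
    unfolding cube_adj_def d_def[symmetric] by auto
qed

lemma cube_adj_Cons [simp]:
  "cube_adj (a # x) (b # y) \<longleftrightarrow> a = b \<and> cube_adj x y \<or> a \<noteq> b \<and> x = y"
proof (cases "length x = length y")
  case True
  define D where "D = {i. i < length x \<and> x ! i \<noteq> y ! i}"
  have "finite D" by (simp add: D_def)
  \<comment> \<open>Position 0 contributes a difference exactly when the heads differ; the other
    differences are those of the tails, shifted by one.\<close>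
  have "{i. i < length (a # x) \<and> (a # x) ! i \<noteq> (b # y) ! i} = (if a = b then {} else {0}) \<union> Suc ` D"
    (is "?L = ?R")
  proof (rule set_eqI)
    fix i show "i \<in> ?L \<longleftrightarrow> i \<in> ?R"
      by (cases i) (auto simp: D_def)
  qed
  then have "card {i. i < length (a # x) \<and> (a # x) ! i \<noteq> (b # y) ! i}
      = (if a = b then 0 else 1) + card D"
    using \<open>finite D\<close> by (simp add: card_image card_insert_disjoint)
  moreover have "card D = 0 \<longleftrightarrow> x = y"
    using True \<open>finite D\<close> by (auto simp: D_def list_eq_iff_nth_eq)
  ultimately show ?thesis
    using True by (auto simp: cube_adj_def D_def)
qed (auto simp: cube_adj_def)

lemma not_cube_adj_Nil [simp]: "\<not> cube_adj [] x" "\<not> cube_adj x []"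
  by (auto simp: cube_adj_def)

text \<open>The cube on \<open>m + n\<close> coordinates is the Cartesian product of the cubes on
  \<open>m\<close> and on \<open>n\<close> coordinates. Through this identity, products of graphs
  are realised by concatenating words.\<close>

lemma cube_adj_append:
  "length x = length x' \<Longrightarrow>
    cube_adj (x @ u) (x' @ u') \<longleftrightarrow> x = x' \<and> cube_adj u u' \<or> cube_adj x x' \<and> u = u'"
  by (induction x x' rule: list_induct2) auto

lemma append_sets_cube: "cube m \<odot> cube n = cube (m + n)"
proof
  show "cube (m + n) \<subseteq> cube m \<odot> cube n"
  proof
    fix x assume "x \<in> cube (m + n)"
    then have "x = take m x @ drop m x" "take m x \<in> cube m" "drop m x \<in> cube n"
      by (simp_all add: cube_def)
    then show "x \<in> cube m \<odot> cube n"
      unfolding append_sets_def by blast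
  qed
qed (auto simp: append_sets_def cube_def)

lemma append_sets_assoc: "(A \<odot> B) \<odot> C = A \<odot> B \<odot> C"
proof -
  have "(A \<odot> B) \<odot> C = {(x @ y) @ z | x y z. x \<in> A \<and> y \<in> B \<and> z \<in> C}"
    unfolding append_sets_def by blast
  also have "\<dots> = {x @ y @ z | x y z. x \<in> A \<and> y \<in> B \<and> z \<in> C}"
    by simp
  also have "\<dots> = A \<odot> B \<odot> C"
    unfolding append_sets_def by blast
  finally show ?thesis .
qed

lemma append_sets_Un: "(A \<union> B) \<odot> C = A \<odot> C \<union> B \<odot> C"
  by (auto simp: append_sets_def)

lemma append_sets_empty [simp]: "{} \<odot> C = {}"
  by (auto simp: append_sets_def)

lemma append_sets_disjoint:
  assumes "A \<inter> B = {}" "A \<subseteq> cube n" "B \<subseteq> cube n"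
  shows "(A \<odot> C) \<inter> (B \<odot> C) = {}"
proof -
  have "length x = n" if "x \<in> A \<union> B" for x
    using assms(2,3) that by (auto simp: cube_def)
  then show ?thesis
    using assms(1) by (auto simp: append_sets_def)
qed

text \<open>The words of \<open>A\<close> share one length, so a concatenation splits in only one
  way.\<close>

lemma card_append_sets_cube:
  assumes "A \<subseteq> cube n"
  shows "card (A \<odot> C) = card A * card C"
proof -
  have "length x = n" if "x \<in> A" for x
    using assms that by (auto simp: cube_def)
  then have "inj_on (\<lambda>(x, y). x @ y) (A \<times> C)"
    by (auto simp: inj_on_def)
  moreover have "A \<odot> C = (\<lambda>(x, y). x @ y) ` (A \<times> C)"
    by (auto simp: append_sets_def)
  ultimately show ?thesis
    by (simp add: card_image card_cartesian_product)
qed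

lemma finite_cube: "finite (cube n)"
  using finite_lists_length_eq[of "UNIV :: bool set" n] by (simp add: cube_def)

lemma card_cube: "card (cube n) = 2 ^ n"
  using card_lists_length_eq[of "UNIV :: bool set" n] by (simp add: cube_def)

lemma cube_0: "cube 0 = {[]}"
  by (auto simp: cube_def)

lemma cube_1: "cube 1 = {[False], [True]}"
  by (auto simp: cube_def length_Suc_conv)

subsection \<open>Induced paths\<close>

lemma induced_path_image: "induced_path n s p \<Longrightarrow> p ` {..<s} \<subseteq> cube n"
  by (auto simp: induced_path_def cube_def)

lemma induced_path_inj: "induced_path n s p \<Longrightarrow> inj_on p {..<s}"
  by (auto simp: induced_path_def inj_on_def)

lemma card_induced_path: "induced_path n s p \<Longrightarrow> card (p ` {..<s}) = s"
  by (simp add: card_image induced_path_inj)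

lemma induced_path_segment:
  "induced_path n s p \<Longrightarrow> a + b \<le> s \<Longrightarrow> induced_path n b (\<lambda>i. p (a + i))"
  by (auto simp: induced_path_def)

lemma induced_path_take: "induced_path n s p \<Longrightarrow> b \<le> s \<Longrightarrow> induced_path n b p"
  using induced_path_segment[of n s p 0 b] by simp

lemma induced_path_append:
  "induced_path n s p \<Longrightarrow> induced_path (n + length u) s (\<lambda>i. p i @ u)"
  unfolding induced_path_def by (auto simp: cube_adj_append)

lemma induced_path_join:
  assumes "induced_path n a p" "induced_path n b q"
    and "\<And>i j. i < a \<Longrightarrow> j < b \<Longrightarrow>
      p i \<noteq> q j \<and> (cube_adj (p i) (q j) \<longleftrightarrow> Suc i = a \<and> j = 0)"
  shows "induced_path n (a + b) (\<lambda>i. if i < a then p i else q (i - a))"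
    (is "induced_path n _ ?r")
  unfolding induced_path_def
proof (intro conjI allI impI)
  fix i assume "i < a + b"
  then show "length (?r i) = n"
    using assms(1,2) by (auto simp: induced_path_def)
next
  fix i j assume ij: "i < a + b" "j < a + b"
  have p: "p i' = p j' \<longleftrightarrow> i' = j'" "cube_adj (p i') (p j') \<longleftrightarrow> j' = Suc i' \<or> i' = Suc j'"
    if "i' < a" "j' < a" for i' j'
    using assms(1) that by (auto simp: induced_path_def)
  have q: "q i' = q j' \<longleftrightarrow> i' = j'" "cube_adj (q i') (q j') \<longleftrightarrow> j' = Suc i' \<or> i' = Suc j'"
    if "i' < b" "j' < b" for i' j'
    using assms(2) that by (auto simp: induced_path_def)
  have sym: "cube_adj (q j') (p i') \<longleftrightarrow> Suc i' = a \<and> j' = 0" "q j' \<noteq> p i'"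
    if "i' < a" "j' < b" for i' j'
    using assms(3)[OF that] cube_adj_sym by metis+
  consider "i < a" "j < a" | "i < a" "a \<le> j" | "a \<le> i" "j < a" | "a \<le> i" "a \<le> j"
    by linarith
  note cases = this
  show "?r i = ?r j \<longleftrightarrow> i = j"
    using cases
  proof cases
    case 1 then show ?thesis using p by simp
  next
    case 2 then show ?thesis using assms(3)[of i "j - a"] ij by auto
  next
    case 3 then show ?thesis using sym(2)[of j "i - a"] ij by auto
  next
    case 4 then show ?thesis using q(1)[of "i - a" "j - a"] ij by auto
  qed
  show "cube_adj (?r i) (?r j) \<longleftrightarrow> j = Suc i \<or> i = Suc j"
    using cases
  proof cases
    case 1 then show ?thesis using p by simp
  next
    case 2 then show ?thesis using assms(3)[of i "j - a"] ij by auto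
  next
    case 3 then show ?thesis using sym(1)[of j "i - a"] ij by auto
  next
    case 4 then show ?thesis using q(2)[of "i - a" "j - a"] ij by auto
  qed
qed

lemma lessThan_add: "{..<a + b :: nat} = {..<a} \<union> (\<lambda>i. a + i) ` {..<b}"
  by (auto simp: lessThan_atLeast0 image_add_atLeastLessThan)

lemma induced_path_join_image:
  fixes p q :: "nat \<Rightarrow> 'a"
  shows "(\<lambda>i. if i < a then p i else q (i - a)) ` {..<a + b} = p ` {..<a} \<union> q ` {..<b}"
proof -
  have "(\<lambda>i. if i < a then p i else q (i - a)) ` {..<a} = p ` {..<a}"
    by simp
  moreover have "(\<lambda>i. if i < a then p i else q (i - a)) ` (\<lambda>i. a + i) ` {..<b} = q ` {..<b}"
    unfolding image_image by (rule image_cong) simp_all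
  ultimately show ?thesis
    by (simp only: lessThan_add image_Un)
qed

lemma path_tiled_Un:
  assumes "path_tiled n s B" "path_tiled n s A" "A \<inter> B = {}"
  shows "path_tiled n s (A \<union> B)"
  using assms
proof (induction rule: path_tiled.induct)
  case (insert B p)
  then have "path_tiled n s ((A \<union> B) \<union> p ` {..<s})"
    by (intro path_tiled.insert) auto
  then show ?case by (simp add: Un_assoc)
qed simp

lemma path_tiled_path: "induced_path n s p \<Longrightarrow> path_tiled n s (p ` {..<s})"
  using path_tiled.insert[OF path_tiled.empty] by fastforce

text \<open>Segments of an induced path are induced paths, so cutting into consecutive blocks of
  \<open>s\<close> vertices suffices.\<close>

lemma path_tiled_multiple:
  "induced_path n (c * s) p \<Longrightarrow> path_tiled n s (p ` {..<c * s})"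
proof (induction c)
  case 0
  then show ?case by (simp add: path_tiled.empty)
next
  case (Suc c)
  let ?q = "\<lambda>i. p (c * s + i)"
  have eq: "p ` {..<Suc c * s} = p ` {..<c * s} \<union> ?q ` {..<s}"
    using lessThan_add[of "c * s" s] by (simp add: image_Un image_image add.commute)
  have "path_tiled n s (p ` {..<c * s})"
    by (rule Suc.IH) (rule induced_path_take[OF Suc.prems], simp)
  moreover have "induced_path n s ?q"
    using Suc.prems by (rule induced_path_segment) simp
  moreover have "p ` {..<c * s} \<inter> ?q ` {..<s} = {}"
    using Suc.prems by (auto simp: induced_path_def)
  ultimately show ?case
    unfolding eq by (rule path_tiled.insert)
qed

lemma path_tiled_image: "path_tiled n s A \<Longrightarrow> A \<subseteq> cube n"
  by (induction rule: path_tiled.induct) (auto dest: induced_path_image)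

subsection \<open>Packings\<close>

lemma packs_mono: "packs F n A k \<Longrightarrow> k \<le> k' \<Longrightarrow> packs F n A k'"
  unfolding packs_def by (meson order_trans)

lemma packs_trivial: "card A \<le> k \<Longrightarrow> packs F n A k"
  unfolding packs_def by (rule exI[of _ "{}"]) auto

lemma packs_Un:
  assumes "packs F n A a" "packs F n B b" "A \<inter> B = {}"
  shows "packs F n (A \<union> B) (a + b)"
proof -
  obtain \<C> where C: "\<forall>X\<in>\<C>. \<exists>\<phi>. cube_embedding F n \<phi> \<and> X = \<phi> ` pverts F"
    "pairwise disjnt \<C>" "\<Union>\<C> \<subseteq> A" "card (A - \<Union>\<C>) \<le> a"
    using assms(1) unfolding packs_def by (elim exE conjE)
  obtain \<D> where D: "\<forall>X\<in>\<D>. \<exists>\<phi>. cube_embedding F n \<phi> \<and> X = \<phi> ` pverts F"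
    "pairwise disjnt \<D>" "\<Union>\<D> \<subseteq> B" "card (B - \<Union>\<D>) \<le> b"
    using assms(2) unfolding packs_def by (elim exE conjE)
  have "(A \<union> B) - \<Union>(\<C> \<union> \<D>) = (A - \<Union>\<C>) \<union> (B - \<Union>\<D>)"
    using C(3) D(3) assms(3) by blast
  then have 1: "card ((A \<union> B) - \<Union>(\<C> \<union> \<D>)) \<le> a + b"
    using card_Un_le[of "A - \<Union>\<C>" "B - \<Union>\<D>"] C(4) D(4) by simp
  have XY: "disjnt X Y" "disjnt Y X" if "X \<in> \<C>" "Y \<in> \<D>" for X Y
  proof -
    have "X \<subseteq> A" "Y \<subseteq> B"
      using that C(3) D(3) by blast+
    then show "disjnt X Y" "disjnt Y X"
      using assms(3) unfolding disjnt_def by blast+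
  qed
  have 2: "pairwise disjnt (\<C> \<union> \<D>)"
  proof (rule pairwiseI)
    fix X Y assume "X \<in> \<C> \<union> \<D>" "Y \<in> \<C> \<union> \<D>" "X \<noteq> Y"
    then show "disjnt X Y"
      using XY pairwiseD[OF C(2)] pairwiseD[OF D(2)] by (elim UnE) simp_all
  qed
  have 3: "\<Union>(\<C> \<union> \<D>) \<subseteq> A \<union> B"
    using C(3) D(3) by blast
  have 4: "\<forall>X\<in>\<C> \<union> \<D>. \<exists>\<phi>. cube_embedding F n \<phi> \<and> X = \<phi> ` pverts F"
    unfolding ball_Un using C(1) D(1) by (rule conjI)
  show ?thesis
    unfolding packs_def by (intro exI[of _ "\<C> \<union> \<D>"] conjI 1 2 3 4)
qed

text \<open>Each path of the tiling costs at most \<open>k\<close>. As \<open>s >= 1\<close>, the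
  number of paths is at most \<open>card A\<close>; this crude count suffices, since only its
  boundedness matters later.\<close>

lemma packs_tiled:
  assumes "path_tiled n s A" "s \<ge> 1"
    and "\<And>p. induced_path n s p \<Longrightarrow> packs F (n + j) (p ` {..<s} \<odot> cube j) k"
  shows "packs F (n + j) (A \<odot> cube j) (card A * k)"
  using assms(1)
proof (induction rule: path_tiled.induct)
  case empty
  then show ?case by (simp add: packs_trivial)
next
  case (insert A p)
  let ?P = "p ` {..<s}"
  have fin: "finite A"
    using path_tiled_image[OF insert(1)] finite_cube finite_subset by blast
  have "packs F (n + j) (A \<odot> cube j \<union> ?P \<odot> cube j) (card A * k + k)"
    using insert.IH assms(3)[OF insert(2)]
    by (rule packs_Un)
      (rule append_sets_disjoint[OF insert(3) path_tiled_image[OF insert(1)] induced_path_image[OF insert(2)]])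
  moreover have "card (A \<union> ?P) = card A + s"
    using fin insert(3) by (simp add: card_Un_disjoint card_induced_path[OF insert(2)])
  ultimately show ?case
    using assms(2) by (auto simp: append_sets_Un algebra_simps intro: packs_mono)
qed

section \<open>Product of an induced path with a packing\<close>

lemma cart_power_Suc_verts:
  "pverts (cart_power G (Suc t)) = {u # us | u us. u \<in> pverts G \<and> us \<in> pverts (cart_power G t)}"
  by (auto simp: cart_prod_def Let_def image_iff)

lemma cart_power_Suc_arcs:
  "(u # us, v # vs) \<in> parcs (cart_power G (Suc t)) \<longleftrightarrow>
    u = v \<and> u \<in> pverts G \<and> (us, vs) \<in> parcs (cart_power G t) \<or>
    us = vs \<and> us \<in> pverts (cart_power G t) \<and> (u, v) \<in> parcs G"
  by (force simp: cart_prod_def Let_def image_iff)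

text \<open>The first coordinate is embedded by \<open>p\<close> and the others by \<phi>. The two
  alternatives in \<open>cube_adj_append\<close> are then the two kinds of edges of a Cartesian
  product.\<close>

lemma path_product_embedding:
  assumes p: "induced_path m l p" and \<phi>: "cube_embedding (cart_power (path_graph l) t) n \<phi>"
  defines "\<psi> \<equiv> (\<lambda>xs. p (hd xs) @ \<phi> (tl xs))"
  shows "cube_embedding (cart_power (path_graph l) (Suc t)) (m + n) \<psi>"
    and "\<psi> ` pverts (cart_power (path_graph l) (Suc t))
      = p ` {..<l} \<odot> \<phi> ` pverts (cart_power (path_graph l) t)"
proof -
  let ?F = "cart_power (path_graph l) t" and ?F' = "cart_power (path_graph l) (Suc t)"
  have vl: "pverts (path_graph l) = {..<l}"
    by (simp add: path_graph_def)
  have al: "(u, v) \<in> parcs (path_graph l) \<longleftrightarrow> u < l \<and> v < l \<and> (v = Suc u \<or> u = Suc v)" for u v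
    by (simp add: path_graph_def)
  have V: "pverts ?F' = {u # us | u us. u < l \<and> us \<in> pverts ?F}"
    unfolding cart_power_Suc_verts vl by simp
  have len: "length (p u) = m" if "u < l" for u
    using p that by (simp add: induced_path_def)
  have pp: "p u = p v \<longleftrightarrow> u = v" "cube_adj (p u) (p v) \<longleftrightarrow> v = Suc u \<or> u = Suc v"
    if "u < l" "v < l" for u v
    using p that by (auto simp: induced_path_def)
  have \<phi>\<phi>: "\<phi> us = \<phi> vs \<longleftrightarrow> us = vs" "cube_adj (\<phi> us) (\<phi> vs) \<longleftrightarrow> (us, vs) \<in> parcs ?F"
    if "us \<in> pverts ?F" "vs \<in> pverts ?F" for us vs
    using \<phi> that by (auto simp: cube_embedding_def inj_on_def)
  show img: "\<psi> ` pverts ?F' = p ` {..<l} \<odot> \<phi> ` pverts ?F"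
    unfolding V append_sets_def by (force simp: \<psi>_def image_iff)
  have "length (\<phi> us) = n" if "us \<in> pverts ?F" for us
    using \<phi> that by (auto simp: cube_embedding_def cube_def)
  then have "\<psi> ` pverts ?F' \<subseteq> cube (m + n)"
    unfolding img using len by (auto simp: append_sets_def cube_def)
  moreover have "inj_on \<psi> (pverts ?F')"
    unfolding inj_on_def V \<psi>_def by (auto simp: len pp \<phi>\<phi>)
  moreover have "cube_adj (\<psi> x) (\<psi> y) \<longleftrightarrow> (x, y) \<in> parcs ?F'" if "x \<in> pverts ?F'" "y \<in> pverts ?F'" for x y
    using that unfolding V
    by (auto simp del: cart_power.simps
        simp: cart_power_Suc_arcs al vl \<psi>_def cube_adj_append len pp \<phi>\<phi>)
  ultimately show "cube_embedding ?F' (m + n) \<psi>"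
    unfolding cube_embedding_def by blast
qed

text \<open>Multiplying every copy in the packing of \<open>B\<close> by the path gives disjoint
  copies of the next power, and each vertex of \<open>B\<close> that was missed leaves
  \<open>l\<close> vertices uncovered.\<close>

lemma packs_path_product:
  assumes p: "induced_path m l p" and B: "packs (cart_power (path_graph l) t) n B k" "finite B"
  shows "packs (cart_power (path_graph l) (Suc t)) (m + n) (p ` {..<l} \<odot> B) (l * k)"
proof -
  let ?F = "cart_power (path_graph l) t" and ?F' = "cart_power (path_graph l) (Suc t)"
  let ?P = "p ` {..<l}"
  obtain \<C> where C: "\<forall>X\<in>\<C>. \<exists>\<phi>. cube_embedding ?F n \<phi> \<and> X = \<phi> ` pverts ?F"
    "pairwise disjnt \<C>" "\<Union>\<C> \<subseteq> B" "card (B - \<Union>\<C>) \<le> k"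
    using B(1) unfolding packs_def by blast
  let ?D = "(\<lambda>X. ?P \<odot> X) ` \<C>"
  have len: "length x = m" if "x \<in> ?P" for x
    using induced_path_image[OF p] that by (auto simp: cube_def)
  have "\<exists>\<phi>. cube_embedding ?F' (m + n) \<phi> \<and> X = \<phi> ` pverts ?F'" if "X \<in> ?D" for X
  proof -
    obtain \<phi> where \<phi>: "cube_embedding ?F n \<phi>" and X: "X = ?P \<odot> \<phi> ` pverts ?F"
      using \<open>X \<in> ?D\<close> C(1) by auto
    show ?thesis
      using path_product_embedding[OF p \<phi>] unfolding X by metis
  qed
  then have 1: "\<forall>X\<in>?D. \<exists>\<phi>. cube_embedding ?F' (m + n) \<phi> \<and> X = \<phi> ` pverts ?F'"
    by blast
  have disj: "disjnt (?P \<odot> X) (?P \<odot> Y)" if "disjnt X Y" for X Y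
    using that len by (auto simp: disjnt_iff append_sets_def)
  have 2: "pairwise disjnt ?D"
  proof (rule pairwiseI)
    fix X Y assume "X \<in> ?D" "Y \<in> ?D" "X \<noteq> Y"
    then obtain X' Y' where "X = ?P \<odot> X'" "Y = ?P \<odot> Y'" "X' \<in> \<C>" "Y' \<in> \<C>" "X' \<noteq> Y'"
      by auto
    then show "disjnt X Y"
      using C(2) disj by (simp add: pairwise_def)
  qed
  have union: "\<Union>?D = ?P \<odot> \<Union>\<C>"
    unfolding append_sets_def by blast
  have 3: "\<Union>?D \<subseteq> ?P \<odot> B"
    unfolding union using C(3) by (auto simp: append_sets_def)
  have sub: "?P \<odot> B - \<Union>?D \<subseteq> ?P \<odot> (B - \<Union>\<C>)"
  proof
    fix x assume x: "x \<in> ?P \<odot> B - \<Union>?D"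
    then obtain a b where ab: "x = a @ b" "a \<in> ?P" "b \<in> B"
      by (auto simp: append_sets_def)
    then have "b \<notin> \<Union>\<C>"
      using x unfolding union append_sets_def by blast
    then show "x \<in> ?P \<odot> (B - \<Union>\<C>)"
      using ab unfolding append_sets_def by blast
  qed
  have "?P \<odot> (B - \<Union>\<C>) = (\<lambda>(x, y). x @ y) ` (?P \<times> (B - \<Union>\<C>))"
    by (auto simp: append_sets_def)
  then have "finite (?P \<odot> (B - \<Union>\<C>))"
    using B(2) by simp
  then have "card (?P \<odot> B - \<Union>?D) \<le> card (?P \<odot> (B - \<Union>\<C>))"
    using sub by (rule card_mono)
  also have "\<dots> = l * card (B - \<Union>\<C>)"
    by (simp add: card_append_sets_cube[OF induced_path_image[OF p]] card_induced_path[OF p])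
  also have "\<dots> \<le> l * k"
    using C(4) by simp
  finally show ?thesis
    unfolding packs_def by (intro exI[of _ ?D] conjI 1 2 3)
qed

subsection \<open>The ladder over an induced path\<close>

lemma append_sets_cube_1: "A \<odot> cube 1 = (\<lambda>x. x @ [b]) ` A \<union> (\<lambda>x. x @ [\<not> b]) ` A"
  unfolding cube_1 append_sets_def by (cases b) auto

text \<open>
  With each turn the zigzag uses both vertices of one column, so \<open>r\<close> turns absorb the residue \<open>r\<close> of
  the path's length modulo \<open>l\<close>; consecutive turns are \<open>l + 1\<close> columns apart.
\<close>

lemma ladder_zigzag:
  assumes "induced_path n s p" "l \<ge> 1" "s = q * l + r" "r \<le> q"
  shows "\<exists>z. induced_path (Suc n) (s + r) z \<and> z 0 = p 0 @ [b] \<and>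
    z ` {..<s + r} \<subseteq> p ` {..<s} \<odot> cube 1 \<and>
    path_tiled (Suc n) l (p ` {..<s} \<odot> cube 1 - z ` {..<s + r})"
  using assms
proof (induction r arbitrary: s p q b)
  case 0
  \<comment> \<open>Without turns the zigzag is the row on side \<open>b\<close>; the other row has
    \<open>q * l\<close> vertices and is cut into blocks of \<open>l\<close>.\<close>
  have s: "s = q * l" using 0 by simp
  have rows: "p ` {..<s} \<odot> cube 1 = (\<lambda>i. p i @ [b]) ` {..<s} \<union> (\<lambda>i. p i @ [\<not> b]) ` {..<s}"
    by (simp only: append_sets_cube_1[of _ b] image_image)
  have path: "induced_path (Suc n) s (\<lambda>i. p i @ [c])" for c
    using induced_path_append[OF 0(1), of "[c]"] by simp
  have "p ` {..<s} \<odot> cube 1 - (\<lambda>i. p i @ [b]) ` {..<s} = (\<lambda>i. p i @ [\<not> b]) ` {..<s}"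
    unfolding rows by auto
  moreover have "path_tiled (Suc n) l ((\<lambda>i. p i @ [\<not> b]) ` {..<s})"
    using path path_tiled_multiple unfolding s by blast
  ultimately show ?case
    using path rows by (intro exI[of _ "\<lambda>i. p i @ [b]"]) (simp del: One_nat_def)
next
  case (Suc r)
  obtain q' where q: "q = Suc q'" using Suc.prems(4) by (cases q) auto
  \<comment> \<open>One turn uses up the first \<open>Suc l\<close> columns and lowers both the
    quotient and the residue by one, so the inequality between them survives. The rest starts on the
    other side, which is why \<open>b\<close> and \<open>p\<close> vary in the induction.\<close>
  define s' where "s' = q' * l + r"
  have s: "s = Suc l + s'" using Suc.prems(3) by (simp add: q s'_def)
  define p' where "p' = (\<lambda>i. p (Suc l + i))"
  have path': "induced_path n s' p'"
    unfolding p'_def using Suc.prems(1) s by (intro induced_path_segment) auto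
  obtain z' where z': "induced_path (Suc n) (s' + r) z'" "z' 0 = p' 0 @ [\<not> b]"
    "z' ` {..<s' + r} \<subseteq> p' ` {..<s'} \<odot> cube 1"
    "path_tiled (Suc n) l (p' ` {..<s'} \<odot> cube 1 - z' ` {..<s' + r})"
    using Suc.IH[OF path' Suc.prems(2) s'_def, of "\<not> b"] Suc.prems(4) q by auto
  have inj: "p i = p j \<longleftrightarrow> i = j" and adj: "cube_adj (p i) (p j) \<longleftrightarrow> j = Suc i \<or> i = Suc j"
    and len: "length (p i) = n" if "i < s" "j < s" for i j
    using Suc.prems(1) that by (auto simp: induced_path_def)
  have len': "length (p i) = length (p j)" if "i < s" "j < s" for i j
    using len that by metis
  have zinj: "z' i = z' j \<longleftrightarrow> i = j" if "i < s' + r" "j < s' + r" for i j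
    using z'(1) that by (auto simp: induced_path_def)
  \<comment> \<open>The turn takes both vertices of column 0 and then follows the side opposite to
    \<open>b\<close> through column \<open>l\<close>; \<open>z'\<close> continues on that side from
    column \<open>Suc l\<close>.\<close>
  define w where "w = (\<lambda>i. if i < 1 then p 0 @ [b] else p (i - 1) @ [\<not> b])"
  define z where "z = (\<lambda>i. if i < 1 + Suc l then w i else z' (i - (1 + Suc l)))"
  have row: "induced_path (Suc n) (Suc l) (\<lambda>i. p i @ [\<not> b])"
    using induced_path_append[OF induced_path_take[OF Suc.prems(1)], of "Suc l" "[\<not> b]"] s by simp
  have start: "induced_path (Suc n) 1 (\<lambda>i. p 0 @ [b])"
    using len[of 0 0] s by (simp add: induced_path_def)
  have w: "induced_path (Suc n) (1 + Suc l) w"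
    unfolding w_def
  proof (rule induced_path_join[OF start row])
    fix i j :: nat assume "i < 1" "j < Suc l"
    then show "p 0 @ [b] \<noteq> p j @ [\<not> b] \<and>
        (cube_adj (p 0 @ [b]) (p j @ [\<not> b]) \<longleftrightarrow> Suc i = 1 \<and> j = 0)"
      using s len'[of 0 j] inj[of 0 j] by (auto simp: cube_adj_append)
  qed
  have z: "induced_path (Suc n) ((1 + Suc l) + (s' + r)) z"
    unfolding z_def
  proof (rule induced_path_join[OF w z'(1)])
    fix i j assume i: "i < 1 + Suc l" and j: "j < s' + r"
    obtain k c where k: "k < s'" "z' j = p (Suc l + k) @ [c]"
      using z'(3) j unfolding append_sets_cube_1[of _ True] p'_def by blast
    \<comment> \<open>Truncated subtraction is intended: \<open>w\<close> is in column 0 both at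
      \<open>i = 0\<close> and at \<open>i = 1\<close>.\<close>
    define x where "x = i - 1"
    have wi: "w i = p x @ [i = 0 \<longleftrightarrow> b]" and x: "x \<le> l"
      using i by (auto simp: w_def x_def)
    have "w i \<noteq> z' j"
      using wi k x inj[of x "Suc l + k"] s by auto
    moreover have "cube_adj (w i) (z' j) \<longleftrightarrow> x = l \<and> k = 0 \<and> c = (i = 0 \<longleftrightarrow> b)"
      unfolding wi k(2) using x k(1) s len'[of x "Suc l + k"] inj[of x "Suc l + k"] adj[of x "Suc l + k"]
      by (auto simp: cube_adj_append)
    \<comment> \<open>Since \<open>l >= 1\<close>, the vertex at \<open>i = 0\<close> is not in
      column \<open>l\<close>. So the only contact between the two pieces is the intended joining
      edge.\<close>
    moreover have "x = l \<and> k = 0 \<and> c = (i = 0 \<longleftrightarrow> b) \<longleftrightarrow> Suc i = 1 + Suc l \<and> j = 0"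
    proof
      assume *: "x = l \<and> k = 0 \<and> c = (i = 0 \<longleftrightarrow> b)"
      then have "i = Suc l"
        using Suc.prems(2) by (auto simp: x_def)
      moreover have "z' j = z' 0"
        using * k(2) z'(2) \<open>i = Suc l\<close> by (simp add: p'_def)
      then have "j = 0"
        using zinj[OF j, of 0] j by linarith
      ultimately show "Suc i = 1 + Suc l \<and> j = 0" by simp
    next
      assume *: "Suc i = 1 + Suc l \<and> j = 0"
      then have "p (Suc l + k) = p (Suc l)" "c = (\<not> b)"
        using k(2) z'(2) by (auto simp: p'_def)
      then show "x = l \<and> k = 0 \<and> c = (i = 0 \<longleftrightarrow> b)"
        using * inj[of "Suc l + k" "Suc l"] k(1) s by (simp add: x_def)
    qed
    ultimately show "w i \<noteq> z' j \<and> (cube_adj (w i) (z' j) \<longleftrightarrow> Suc i = 1 + Suc l \<and> j = 0)"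
      by blast
  qed
  have z0: "z 0 = p 0 @ [b]" by (simp add: z_def w_def)
  define A where "A = {p 0 @ [b]} \<union> (\<lambda>i. p i @ [\<not> b]) ` {..<Suc l}"
  \<comment> \<open>The vertices of the first \<open>Suc l\<close> columns that the turn misses:
    columns 1 to \<open>l\<close> on side \<open>b\<close>, a single induced path of exactly
    \<open>l\<close> vertices.\<close>
  define T where "T = (\<lambda>i. p (1 + i) @ [b]) ` {..<l}"
  let ?L = "p ` {..<s} \<odot> cube 1" and ?L' = "p' ` {..<s'} \<odot> cube 1"
    and ?Z = "z ` {..<s + Suc r}" and ?Z' = "z' ` {..<s' + r}"
  have "?Z = z ` {..<(1 + Suc l) + (s' + r)}"
    by (simp add: s ac_simps)
  also have "\<dots> = w ` {..<1 + Suc l} \<union> ?Z'"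
    unfolding z_def by (rule induced_path_join_image)
  also have "w ` {..<1 + Suc l} = A"
    unfolding w_def A_def using induced_path_join_image[of 1 "\<lambda>_. p 0 @ [b]" "\<lambda>i. p i @ [\<not> b]" "Suc l"]
    by (simp add: lessThan_Suc)
  finally have Z: "?Z = A \<union> ?Z'" .
  have "p ` {..<s} = p ` {..<Suc l} \<union> p' ` {..<s'}"
    unfolding s lessThan_add image_Un image_image p'_def ..
  then have "?L = p ` {..<Suc l} \<odot> cube 1 \<union> ?L'"
    by (simp add: append_sets_Un)
  also have "p ` {..<Suc l} \<odot> cube 1
      = (\<lambda>i. p i @ [b]) ` {..<Suc l} \<union> (\<lambda>i. p i @ [\<not> b]) ` {..<Suc l}"
    by (simp only: append_sets_cube_1[of _ b] image_image)
  also have "(\<lambda>i. p i @ [b]) ` {..<Suc l} = {p 0 @ [b]} \<union> T"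
    using lessThan_add[of 1 l] by (simp add: T_def image_Un image_image lessThan_Suc)
  finally have L: "?L = A \<union> T \<union> ?L'"
    unfolding A_def by blast
  have AT: "A \<inter> T = {}"
    using inj s by (auto simp: A_def T_def)
  have "p i \<noteq> p (Suc l + x)" if "i < Suc l" "x < s'" for i x
    using inj[of i "Suc l + x"] s that by simp
  then have "p i @ [c] \<notin> ?L'" if "i < Suc l" for i c
    using that unfolding append_sets_cube_1[of _ True] by (auto simp: p'_def)
  then have ATL: "(A \<union> T) \<inter> ?L' = {}"
    by (auto simp: A_def T_def)
  have rest: "?L - ?Z = (?L' - ?Z') \<union> T"
    using Z L AT ATL z'(3) by blast
  have "induced_path (Suc n) l (\<lambda>i. p (1 + i) @ [b])"
    using induced_path_append[OF induced_path_segment[OF Suc.prems(1)], of 1 l "[b]"] s by simp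
  then have "path_tiled (Suc n) l (?L - ?Z)"
    unfolding rest T_def using ATL by (intro path_tiled.insert[OF z'(4)]) (auto simp: T_def)
  moreover have "?Z \<subseteq> ?L"
    using Z L z'(3) by blast
  moreover have "induced_path (Suc n) (s + Suc r) z"
    using z by (simp add: s ac_simps)
  ultimately show ?case
    using z0 by blast
qed

text \<open>The threshold \<open>l * l\<close> guarantees \<open>s mod l < l <= s div l\<close>, so
  there is room for all turns of the zigzag. Its far end is then trimmed in blocks of
  \<open>l\<close>, which keeps the path length in a window that is the same for every further
  ladder.\<close>

lemma ladder_step:
  assumes p: "induced_path n s p" and l: "l \<ge> 1" "l * l \<le> S" "S \<le> s"
  shows "\<exists>s' z. S \<le> s' \<and> s' < S + l \<and> induced_path (Suc n) s' z \<and>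
    z ` {..<s'} \<subseteq> p ` {..<s} \<odot> cube 1 \<and>
    path_tiled (Suc n) l (p ` {..<s} \<odot> cube 1 - z ` {..<s'})"
proof -
  let ?L = "p ` {..<s} \<odot> cube 1"
  define r where "r = s mod l"
  have "l \<le> s div l"
    using l div_le_mono[of "l * l" s l] by simp
  moreover have "r < l" using l by (simp add: r_def)
  ultimately have "r \<le> s div l" by simp
  then obtain z where z: "induced_path (Suc n) (s + r) z" "z ` {..<s + r} \<subseteq> ?L"
    "path_tiled (Suc n) l (?L - z ` {..<s + r})"
    using ladder_zigzag[OF p l(1) _ \<open>r \<le> s div l\<close>, of True] unfolding r_def by auto
  define c where "c = (s + r - S) div l"
  \<comment> \<open>The least number from \<open>S\<close> upward that is congruent to
    \<open>s + r\<close> modulo \<open>l\<close>, so that the trimmed part consists of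
    \<open>c\<close> whole blocks.\<close>
  define s' where "s' = S + (s + r - S) mod l"
  have eq: "s + r = s' + c * l"
    using l(3) by (simp add: s'_def c_def)
  define z2 where "z2 = (\<lambda>i. z (s' + i))"
  have "induced_path (Suc n) (c * l) z2"
    unfolding z2_def using z(1) eq by (intro induced_path_segment) auto
  then have tail: "path_tiled (Suc n) l (z2 ` {..<c * l})"
    by (rule path_tiled_multiple)
  have split: "z ` {..<s + r} = z ` {..<s'} \<union> z2 ` {..<c * l}"
    unfolding eq lessThan_add image_Un image_image z2_def ..
  have "z ` {..<s'} \<inter> z2 ` {..<c * l} = {}"
    using z(1) unfolding z2_def eq by (auto simp: induced_path_def)
  then have "?L - z ` {..<s'} = (?L - z ` {..<s + r}) \<union> z2 ` {..<c * l}"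
    using z(2) unfolding split by blast
  moreover have "path_tiled (Suc n) l ((?L - z ` {..<s + r}) \<union> z2 ` {..<c * l})"
    using tail z(3) by (rule path_tiled_Un) (auto simp: split)
  ultimately have "path_tiled (Suc n) l (?L - z ` {..<s'})"
    by simp
  moreover have "induced_path (Suc n) s' z"
    using z(1) eq by (intro induced_path_take[OF z(1)]) simp
  moreover have "z ` {..<s'} \<subseteq> ?L"
    using z(2) split by blast
  moreover have "s' < S + l" "S \<le> s'"
    using l(1) by (simp_all add: s'_def)
  ultimately show ?thesis by blast
qed

text \<open>Each step spends one coordinate of the cube on a ladder. The paths on \<open>l\<close>
  vertices split off there are multiplied by packings of \<open>cube j\<close> with
  \<open>j < J\<close>, at cost \<open>l * g\<close> each. When no coordinate is left, the remaining
  path of fewer than \<open>S + l\<close> vertices is given up.\<close>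

lemma packs_path_cube:
  assumes l: "l \<ge> 1" "l * l \<le> S"
    and g: "\<And>i. i < J \<Longrightarrow> packs (cart_power (path_graph l) t) i (cube i) g"
    and "j \<le> J" "induced_path n s p" "S \<le> s" "s < S + l"
  shows "packs (cart_power (path_graph l) (Suc t)) (n + j) (p ` {..<s} \<odot> cube j)
    (S + l + j * (2 * (S + l) * (l * g)))"
  using assms(4-7)
proof (induction j arbitrary: n s p)
  case 0
  have "card (p ` {..<s} \<odot> cube 0) = s"
    by (simp add: card_append_sets_cube[OF induced_path_image[OF 0(2)]]
        card_induced_path[OF 0(2)] card_cube)
  then show ?case
    using 0 by (intro packs_trivial) simp
next
  case (Suc j)
  let ?F = "cart_power (path_graph l) (Suc t)"
  let ?L = "p ` {..<s} \<odot> cube 1"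
  obtain s' z where z: "S \<le> s'" "s' < S + l" "induced_path (Suc n) s' z" "z ` {..<s'} \<subseteq> ?L"
    and tiled: "path_tiled (Suc n) l (?L - z ` {..<s'})"
    using ladder_step[OF Suc.prems(2) l Suc.prems(3)] by blast
  let ?R = "?L - z ` {..<s'}"
  have "packs ?F (Suc n + j) (z ` {..<s'} \<odot> cube j) (S + l + j * (2 * (S + l) * (l * g)))"
    using Suc.prems(1) by (intro Suc.IH z) simp
  moreover have "packs ?F (Suc n + j) (?R \<odot> cube j) (card ?R * (l * g))"
    using tiled l(1)
  proof (rule packs_tiled)
    fix q assume "induced_path (Suc n) l q"
    then show "packs ?F (Suc n + j) (q ` {..<l} \<odot> cube j) (l * g)"
      using g Suc.prems(1) finite_cube by (intro packs_path_product) auto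
  qed
  moreover have "(z ` {..<s'} \<odot> cube j) \<inter> (?R \<odot> cube j) = {}"
    by (rule append_sets_disjoint[OF _ induced_path_image[OF z(3)] path_tiled_image[OF tiled]]) blast
  ultimately have "packs ?F (Suc n + j) (z ` {..<s'} \<odot> cube j \<union> ?R \<odot> cube j)
      (S + l + j * (2 * (S + l) * (l * g)) + card ?R * (l * g))"
    by (rule packs_Un)
  \<comment> \<open>Associativity hands one coordinate over to the ladder: \<open>cube 1\<close> and
    \<open>cube j\<close> together make up \<open>cube (Suc j)\<close>.\<close>
  moreover have "z ` {..<s'} \<odot> cube j \<union> ?R \<odot> cube j = p ` {..<s} \<odot> cube (Suc j)"
  proof -
    have "z ` {..<s'} \<odot> cube j \<union> ?R \<odot> cube j = ?L \<odot> cube j"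
      using z(4) by (simp add: append_sets_Un[symmetric] Un_absorb1)
    then show ?thesis
      using append_sets_cube[of 1 j] by (simp add: append_sets_assoc)
  qed
  \<comment> \<open>The ladder has twice as many vertices as its path, whose length stays below
    \<open>S + l\<close>; hence the cost per coordinate does not grow.\<close>
  moreover have "card ?R \<le> 2 * (S + l)"
  proof -
    have card: "card ?L = s * 2"
      by (simp only: card_append_sets_cube[OF induced_path_image[OF Suc.prems(2)]]
          card_induced_path[OF Suc.prems(2)] card_cube power_one_right)
    have "finite ?L"
      using path_tiled_image[OF tiled] finite_cube finite_subset
      by (metis finite_Diff2 finite_imageI finite_lessThan)
    then have "card ?R \<le> s * 2"
      unfolding card[symmetric] by (intro card_mono) auto
    then show ?thesis
      by (rule order_trans) (use Suc.prems(4) in simp)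
  qed
  then have "card ?R * (l * g) \<le> 2 * (S + l) * (l * g)"
    by (rule mult_le_mono1)
  ultimately show ?case
    by (auto intro: packs_mono)
qed

subsection \<open>Tilings of the cube by long induced paths\<close>

text \<open>The cyclic order 00, 01, 11, 10 of the 4-cycle, extended periodically so that rows of
  the cylinder can be added without explicit reduction modulo 4.\<close>

definition gray :: "nat \<Rightarrow> bool list" where
  "gray k = [odd (k div 2), odd k \<noteq> odd (k div 2)]"

lemma gray_eq_iff: "gray a = gray b \<longleftrightarrow> a mod 4 = b mod 4"
proof -
  have mod4: "k mod 4 = 2 * (k div 2 mod 2) + k mod 2" for k :: nat
    using mod_mult2_eq[of k 2 2] by simp
  have parity: "odd k = odd m \<longleftrightarrow> k mod 2 = m mod 2" for k m :: nat
    by (simp add: mod2_eq_if)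
  have digits: "2 * u + v = 2 * w + z \<longleftrightarrow> u = w \<and> v = z" if "v < 2" "z < 2" for u v w z :: nat
    using that by presburger
  have "gray a = gray b \<longleftrightarrow> odd (a div 2) = odd (b div 2) \<and> odd a = odd b"
    unfolding gray_def list.inject by blast
  also have "\<dots> \<longleftrightarrow> a mod 4 = b mod 4"
    unfolding parity mod4 by (rule digits[symmetric]) simp_all
  finally show ?thesis .
qed

lemma mod_4_add_eq_iff: "(c + a) mod 4 = (c + b) mod 4 \<longleftrightarrow> a mod 4 = b mod 4" for a b c :: nat
  using cong_add_lcancel_nat[of c a b 4] unfolding cong_def .

lemma gray_add_eq_iff: "gray (c + a) = gray (c + b) \<longleftrightarrow> a mod 4 = b mod 4"
  unfolding gray_eq_iff by (rule mod_4_add_eq_iff)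

text \<open>A 4-cycle is the complete bipartite graph between its even and its odd
  positions.\<close>

lemma cube_adj_gray: "cube_adj (gray a) (gray b) \<longleftrightarrow> odd (a + b)"
  unfolding gray_def by auto

text \<open>The offset \<open>k\<close> allows each column of the cylinder to be listed from its own
  starting row.\<close>

lemma cube_2_gray: "cube 2 = (\<lambda>i. gray (k + i)) ` {..<4}"
proof (rule card_subset_eq[symmetric])
  have "inj_on (\<lambda>i. gray (k + i)) {..<4}"
    by (auto simp: inj_on_def gray_add_eq_iff)
  then show "card ((\<lambda>i. gray (k + i)) ` {..<4}) = card (cube 2)"
    by (simp add: card_image card_cube)
qed (auto simp: gray_def cube_def intro: finite_cube[unfolded cube_def])

lemma helix_eq_iff:
  fixes x y e f :: nat
  assumes "e < 2" "f < 2"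
  shows "x = y \<and> (x + e) mod 4 = (y + f) mod 4 \<longleftrightarrow> 2 * x + e = 2 * y + f"
proof (cases "x = y")
  case True
  have "(y + e) mod 4 = (y + f) mod 4 \<longleftrightarrow> e = f"
    using mod_4_add_eq_iff[of y e f] assms by simp
  then show ?thesis using True by simp
next
  case False
  then have "2 * x + e \<noteq> 2 * y + f" using assms by presburger
  then show ?thesis using False by simp
qed

text \<open>Vertex \<open>2 * x + e\<close> of a helix lies in column \<open>x\<close> and row
  \<open>x + e\<close>. Within a column its two rows are consecutive; between columns
  \<open>x\<close> and \<open>x + 1\<close> the only common row is \<open>x + 1\<close>, joining the
  second vertex of one to the first of the next.\<close>

lemma helix_adj_iff:
  fixes x y e f c :: nat
  assumes "e < 2" "f < 2"
  shows "x = y \<and> odd (c + (x + e) + (c + (y + f))) \<or>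
      (y = Suc x \<or> x = Suc y) \<and> (x + e) mod 4 = (y + f) mod 4
    \<longleftrightarrow> 2 * y + f = Suc (2 * x + e) \<or> 2 * x + e = Suc (2 * y + f)"
proof -
  have odd: "odd (c + (x + e) + (c + (y + f))) \<longleftrightarrow> f = Suc e \<or> e = Suc f" if "x = y"
    using assms that by presburger
  have mod: "(a + h) mod 4 = (Suc a + k) mod 4 \<longleftrightarrow> h = Suc k" if "h < 2" "k < 2" for a h k :: nat
    using mod_4_add_eq_iff[of a h "Suc k"] that by simp
  consider "x = y" | "y = Suc x" | "x = Suc y" | "x \<noteq> y" "y \<noteq> Suc x" "x \<noteq> Suc y"
    by blast
  then show ?thesis
  proof cases
    case 1
    then show ?thesis
      using odd by simp
  next
    case 2
    have "(x + e) mod 4 = (y + f) mod 4 \<longleftrightarrow> e = Suc f"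
      unfolding 2 using assms by (rule mod)
    moreover have "2 * y + f = Suc (2 * x + e) \<or> 2 * x + e = Suc (2 * y + f) \<longleftrightarrow> e = Suc f"
      unfolding 2 using assms by presburger
    moreover have "x \<noteq> y"
      using 2 by simp
    ultimately show ?thesis
      using 2 by blast
  next
    case 3
    have "(x + e) mod 4 = (y + f) mod 4 \<longleftrightarrow> f = Suc e"
      unfolding 3 mod[OF assms(2,1), of y, symmetric] by (rule eq_commute)
    moreover have "2 * y + f = Suc (2 * x + e) \<or> 2 * x + e = Suc (2 * y + f) \<longleftrightarrow> f = Suc e"
      unfolding 3 using assms by presburger
    moreover have "x \<noteq> y"
      using 3 by simp
    ultimately show ?thesis
      using 3 by blast
  next
    case 4
    then have "2 * y + f \<noteq> Suc (2 * x + e)" "2 * x + e \<noteq> Suc (2 * y + f)"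
      using assms by presburger+
    then show ?thesis
      using 4 by blast
  qed
qed

text \<open>
  A path times the 4-cycle \<^term>\<open>cube 2\<close> is a cylinder, which is the union of two helices: column
  \<open>x\<close> meets one of them in the rows \<open>x, x + 1\<close> and the other in the rows \<open>x + 2, x + 3\<close> modulo 4.
\<close>

lemma induced_path_helix:
  assumes "induced_path n s p"
  shows "induced_path (n + 2) (2 * s) (\<lambda>i. p (i div 2) @ gray (c + (i + 1) div 2))"
  unfolding induced_path_def
proof (intro conjI allI impI)
  fix i assume "i < 2 * s"
  then show "length (p (i div 2) @ gray (c + (i + 1) div 2)) = n + 2"
    using assms by (auto simp: induced_path_def gray_def)
next
  fix i j assume ij: "i < 2 * s" "j < 2 * s"
  obtain x e where i: "i = 2 * x + e" "e < 2"
    using mult_div_mod_eq[of 2 i] by (metis mod_less_divisor pos2)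
  obtain y f where j: "j = 2 * y + f" "f < 2"
    using mult_div_mod_eq[of 2 j] by (metis mod_less_divisor pos2)
  have p: "p x = p y \<longleftrightarrow> x = y" "cube_adj (p x) (p y) \<longleftrightarrow> y = Suc x \<or> x = Suc y"
    "length (p x) = length (p y)"
    using assms ij i j by (auto simp: induced_path_def)
  have div: "i div 2 = x" "(i + 1) div 2 = x + e" "j div 2 = y" "(j + 1) div 2 = y + f"
    using i j by auto
  have "p x @ u = p y @ v \<longleftrightarrow> x = y \<and> u = v" for u v
    using p(1,3) by simp
  note eq = this[of "gray (c + (x + e))" "gray (c + (y + f))", unfolded gray_add_eq_iff helix_eq_iff[OF i(2) j(2)]]
  show "p (i div 2) @ gray (c + (i + 1) div 2) = p (j div 2) @ gray (c + (j + 1) div 2) \<longleftrightarrow> i = j"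
    using eq unfolding div i(1)[symmetric] j(1)[symmetric] .
  have "cube_adj (p x @ u) (p y @ v) \<longleftrightarrow> x = y \<and> cube_adj u v \<or> (y = Suc x \<or> x = Suc y) \<and> u = v" for u v
    unfolding cube_adj_append[OF p(3)] p(1,2) ..
  note adj = this[of "gray (c + (x + e))" "gray (c + (y + f))",
      unfolded gray_add_eq_iff cube_adj_gray helix_adj_iff[OF i(2) j(2)]]
  show "cube_adj (p (i div 2) @ gray (c + (i + 1) div 2)) (p (j div 2) @ gray (c + (j + 1) div 2))
      \<longleftrightarrow> j = Suc i \<or> i = Suc j"
    using adj unfolding div i(1)[symmetric] j(1)[symmetric] .
qed

lemma path_tiled_helices:
  assumes "induced_path n s p"
  shows "path_tiled (n + 2) (2 * s) (p ` {..<s} \<odot> cube 2)"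
proof -
  define h where "h = (\<lambda>c i. p (i div 2) @ gray (c + (i + 1) div 2))"
  have h: "h c ` {..<2 * s} = (\<Union>x<s. {p x @ gray (c + x), p x @ gray (c + (x + 1))})" (is "_ = ?R") for c
  proof
    show "h c ` {..<2 * s} \<subseteq> ?R"
    proof
      fix y assume "y \<in> h c ` {..<2 * s}"
      then obtain i where i: "i < 2 * s" "y = h c i" by auto
      have "(i + 1) div 2 = i div 2 \<or> (i + 1) div 2 = i div 2 + 1" "i div 2 < s"
        using i(1) by presburger+
      then show "y \<in> ?R"
        unfolding i(2) h_def by auto
    qed
    show "?R \<subseteq> h c ` {..<2 * s}"
    proof
      fix y assume "y \<in> ?R"
      then obtain x where x: "x < s" "y = h c (2 * x) \<or> y = h c (2 * x + 1)"
        by (auto simp: h_def)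
      then show "y \<in> h c ` {..<2 * s}" by fastforce
    qed
  qed
  have "p ` {..<s} \<odot> cube 2 = (\<Union>x<s. (\<lambda>y. p x @ y) ` cube 2)"
    by (auto simp: append_sets_def)
  also have "\<dots> = (\<Union>x<s. {p x @ gray (0 + x), p x @ gray (0 + (x + 1))} \<union>
      {p x @ gray (2 + x), p x @ gray (2 + (x + 1))})"
  proof (intro SUP_cong refl)
    fix x
    have "{..<4::nat} = {0, 1, 2, 3}" by auto
    then show "(\<lambda>y. p x @ y) ` cube 2 = {p x @ gray (0 + x), p x @ gray (0 + (x + 1))} \<union>
        {p x @ gray (2 + x), p x @ gray (2 + (x + 1))}"
      unfolding cube_2_gray[of x] by (auto simp: eval_nat_numeral)
  qed
  also have "\<dots> = h 0 ` {..<2 * s} \<union> h 2 ` {..<2 * s}"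
    unfolding h by blast
  finally have cover: "p ` {..<s} \<odot> cube 2 = h 0 ` {..<2 * s} \<union> h 2 ` {..<2 * s}" .
  have disjoint: "h 0 ` {..<2 * s} \<inter> h 2 ` {..<2 * s} = {}"
  proof -
    have "h 0 i \<noteq> h 2 j" if "i < 2 * s" "j < 2 * s" for i j
    proof
      assume eq: "h 0 i = h 2 j"
      have p: "p (i div 2) = p (j div 2) \<longleftrightarrow> i div 2 = j div 2"
        "length (p (i div 2)) = length (p (j div 2))"
        using assms that by (auto simp: induced_path_def)
      then have x: "i div 2 = j div 2"
        and gray: "gray ((i + 1) div 2) = gray (2 + (j + 1) div 2)"
        using eq by (simp_all add: h_def)
      \<comment> \<open>Within one column, the offsets from the starting row lie in {0, 1} for one
        helix and in {2, 3} for the other.\<close>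
      have "(k + 1) div 2 = k div 2 + k mod 2" for k :: nat
        by presburger
      then have "gray (j div 2 + i mod 2) = gray (j div 2 + (2 + j mod 2))"
        using gray x by (simp add: ac_simps)
      then have "(i mod 2) mod 4 = (2 + j mod 2) mod 4"
        by (rule gray_add_eq_iff[THEN iffD1])
      moreover have "i mod 2 < 2" "j mod 2 < 2" by simp_all
      ultimately show False by simp
    qed
    then show ?thesis by auto
  qed
  have "induced_path (n + 2) (2 * s) (h c)" for c
    unfolding h_def using assms by (rule induced_path_helix)
  then show ?thesis
    unfolding cover using disjoint by (intro path_tiled_Un path_tiled_path)
qed

lemma path_tiled_double:
  "path_tiled n s A \<Longrightarrow> path_tiled (n + 2) (2 * s) (A \<odot> cube 2)"
proof (induction rule: path_tiled.induct)
  case (insert A p)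
  show ?case
    unfolding append_sets_Un
    by (rule path_tiled_Un[OF path_tiled_helices[OF insert(2)] insert.IH])
      (rule append_sets_disjoint[OF insert(3) path_tiled_image[OF insert(1)] induced_path_image[OF insert(2)]])
qed (simp add: path_tiled.empty)

text \<open>Starting from a single vertex, every two further coordinates double the length of all
  paths.\<close>

lemma path_tiled_cube: "path_tiled (2 * k) (2 ^ k) (cube (2 * k))"
proof (induction k)
  case 0
  have "induced_path 0 1 (\<lambda>_. [])" by (simp add: induced_path_def)
  from path_tiled_path[OF this] show ?case
    by (simp add: cube_0 lessThan_Suc)
next
  case (Suc k)
  from path_tiled_double[OF this] show ?case
    by (simp add: append_sets_cube add.commute)
qed

subsection \<open>Recursion on the number of factors\<close>

lemma packs_cube_Suc:
  assumes "l \<ge> 1"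
  shows "\<exists>K. \<forall>n g. (\<forall>i<n. packs (cart_power (path_graph l) t) i (cube i) g) \<longrightarrow>
    packs (cart_power (path_graph l) (Suc t)) n (cube n) (K * (1 + n * g))"
proof -
  \<comment> \<open>\<open>m\<close> is the dimension in which \<open>path_tiled_cube\<close> yields
    paths on \<open>S\<close> vertices, and \<open>S\<close> exceeds the threshold
    \<open>l * l\<close>. In \<open>K\<close>, the factor \<open>2 ^ m\<close> bounds the number of
    these paths and the rest bounds the cost of one.\<close>
  define S :: nat where "S = 2 ^ (l * l)"
  define m where "m = 2 * (l * l)"
  define K where "K = 2 ^ m * (2 * (S + l) * l)"
  have S: "l * l \<le> S" "S \<ge> 1"
    unfolding S_def using less_exp[of "l * l"] by simp_all
  have "packs (cart_power (path_graph l) (Suc t)) n (cube n) (K * (1 + n * g))"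
    if g: "\<forall>i<n. packs (cart_power (path_graph l) t) i (cube i) g" for n g
  proof (cases "n < m")
    \<comment> \<open>In dimensions below \<open>m\<close> the empty packing is good enough.\<close>
    case True
    have "(2::nat) ^ n \<le> 2 ^ m * 1"
      using True by simp
    also have "\<dots> \<le> 2 ^ m * (2 * (S + l) * l)"
      using assms S(2) by (intro mult_le_mono2) simp
    also have "\<dots> \<le> K * (1 + n * g)"
      by (simp add: K_def)
    finally show ?thesis
      by (intro packs_trivial) (simp add: card_cube)
  next
    case False
    define j where "j = n - m"
    have n: "n = m + j" using False by (simp add: j_def)
    have "packs (cart_power (path_graph l) (Suc t)) (m + j) (cube m \<odot> cube j)
        (card (cube m) * (S + l + j * (2 * (S + l) * (l * g))))"
    proof (rule packs_tiled)
      show "path_tiled m S (cube m)"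
        unfolding m_def S_def by (rule path_tiled_cube)
      fix p assume "induced_path m S p"
      then show "packs (cart_power (path_graph l) (Suc t)) (m + j) (p ` {..<S} \<odot> cube j)
          (S + l + j * (2 * (S + l) * (l * g)))"
        using g S assms by (intro packs_path_cube[where J = n]) (auto simp: n)
    qed (rule S)
    moreover have "S + l + j * (2 * (S + l) * (l * g)) \<le> 2 * (S + l) * l * (1 + n * g)"
    proof -
      have "S + l \<le> 2 * (S + l) * l"
        using assms by (cases l) auto
      moreover have "j * (2 * (S + l) * (l * g)) \<le> n * (2 * (S + l) * (l * g))"
        by (simp add: n)
      ultimately show ?thesis
        by (simp add: algebra_simps)
    qed
    then have "card (cube m) * (S + l + j * (2 * (S + l) * (l * g))) \<le> K * (1 + n * g)"
      unfolding card_cube K_def mult.assoc[of "2 ^ m"] by (rule mult_le_mono2)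
    ultimately show ?thesis
      unfolding append_sets_cube n[symmetric] by (rule packs_mono)
  qed
  then show ?thesis by blast
qed

text \<open>The empty product is a single vertex, so nothing is left uncovered. This starts the
  recursion with \<open>g = 0\<close>.\<close>

lemma packs_points: "packs (cart_power G 0) n A 0"
  if "A \<subseteq> cube n"
proof -
  let ?C = "(\<lambda>x. {x}) ` A"
  have "\<exists>\<phi>. cube_embedding (cart_power G 0) n \<phi> \<and> X = \<phi> ` pverts (cart_power G 0)" if "X \<in> ?C" for X
  proof -
    obtain x where "x \<in> A" "X = {x}" using \<open>X \<in> ?C\<close> by blast
    then show ?thesis
      using \<open>A \<subseteq> cube n\<close> by (intro exI[of _ "\<lambda>_. x"]) (auto simp: cube_embedding_def)
  qed
  moreover have "pairwise disjnt ?C" by (auto simp: pairwise_def)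
  moreover have "\<Union>?C = A" by auto
  ultimately show ?thesis
    unfolding packs_def by (intro exI[of _ ?C]) simp
qed

text \<open>Each application of \<open>packs_cube_Suc\<close> adds one factor of order
  \<open>n\<close>. The base \<open>n + 1\<close> keeps the bound positive at \<open>n = 0\<close>,
  where the single vertex may be uncovered.\<close>

lemma packs_cube:
  assumes "l \<ge> 1"
  shows "\<exists>K. \<forall>n. packs (cart_power (path_graph l) (Suc t)) n (cube n) (K * (n + 1) ^ t)"
proof (induction t)
  case 0
  obtain K where K: "\<And>n g. (\<forall>i<n. packs (cart_power (path_graph l) 0) i (cube i) g) \<Longrightarrow>
    packs (cart_power (path_graph l) (Suc 0)) n (cube n) (K * (1 + n * g))"
    using packs_cube_Suc[OF assms, of 0] by blast
  have "packs (cart_power (path_graph l) (Suc 0)) n (cube n) (K * (n + 1) ^ 0)" for n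
    using K[of n 0] packs_points by force
  then show ?case by blast
next
  case (Suc t)
  obtain C where C: "\<And>n. packs (cart_power (path_graph l) (Suc t)) n (cube n) (C * (n + 1) ^ t)"
    using Suc by blast
  obtain K where K: "\<And>n g. (\<forall>i<n. packs (cart_power (path_graph l) (Suc t)) i (cube i) g) \<Longrightarrow>
    packs (cart_power (path_graph l) (Suc (Suc t))) n (cube n) (K * (1 + n * g))"
    using packs_cube_Suc[OF assms, of "Suc t"] by blast
  have "packs (cart_power (path_graph l) (Suc (Suc t))) n (cube n) (K * (1 + C) * (n + 1) ^ Suc t)" for n
  proof -
    \<comment> \<open>The bound at \<open>n\<close> serves as one common \<open>g\<close> for all
      smaller dimensions.\<close>
    have "packs (cart_power (path_graph l) (Suc t)) i (cube i) (C * (n + 1) ^ t)" if "i < n" for i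
      using C by (rule packs_mono) (use that in \<open>simp add: power_mono\<close>)
    then have "packs (cart_power (path_graph l) (Suc (Suc t))) n (cube n)
        (K * (1 + n * (C * (n + 1) ^ t)))"
      by (intro K) blast
    moreover have "1 + n * (C * (n + 1) ^ t) \<le> (1 + C) * (n + 1) ^ Suc t"
    proof -
      have "1 \<le> (n + 1) ^ Suc t" by (rule one_le_power) simp
      moreover have "n * (C * (n + 1) ^ t) \<le> C * (n + 1) ^ Suc t"
        by simp
      ultimately show ?thesis
        unfolding add_mult_distrib by linarith
    qed
    ultimately show ?thesis
      unfolding mult.assoc by (blast intro: packs_mono mult_le_mono2)
  qed
  then show ?case by blast
qed

subsection \<open>Translation to induced packings\<close>

lemma parcs_hypercube: "(x, y) \<in> parcs (hypercube n) \<longleftrightarrow> x \<in> cube n \<and> y \<in> cube n \<and> cube_adj x y"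
  by (auto simp: hypercube_def cube_def cube_adj_def)

definition induced_by :: "'a pair_pre_digraph \<Rightarrow> 'a set \<Rightarrow> 'a pair_pre_digraph" where
  "induced_by G X = \<lparr> pverts = X, parcs = {(x, y) \<in> parcs G. x \<in> X \<and> y \<in> X} \<rparr>"

lemma cube_embedding_induced_copy:
  assumes F: "pair_graph F" and \<phi>: "cube_embedding F n \<phi>"
  shows "induced_copy F (hypercube n) (induced_by (hypercube n) (\<phi> ` pverts F))"
proof -
  let ?X = "\<phi> ` pverts F"
  let ?H = "induced_by (hypercube n) ?X"
  interpret F: pair_graph F by (rule F)
  interpret Q: pair_graph "hypercube n" by (rule pair_graph_hypercube)
  have sub: "?X \<subseteq> cube n" and inj: "inj_on \<phi> (pverts F)"
    and adj: "\<And>u v. u \<in> pverts F \<Longrightarrow> v \<in> pverts F \<Longrightarrow> cube_adj (\<phi> u) (\<phi> v) \<longleftrightarrow> (u, v) \<in> parcs F"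
    using \<phi> by (auto simp: cube_embedding_def)
  have verts: "pverts (hypercube n) = cube n"
    by (simp add: hypercube_def cube_def)
  have "wf_digraph (with_proj ?H)"
    by unfold_locales (auto simp: induced_by_def)
  moreover have "wf_digraph (with_proj (hypercube n))"
    by (rule Q.wf_digraph_axioms)
  ultimately have "induced_subgraph (with_proj ?H) (with_proj (hypercube n))"
    using sub unfolding induced_subgraph_def subgraph_def compatible_def
    by (auto simp: induced_by_def verts)
  moreover have "digraph_iso (with_proj F) (with_proj ?H)"
    unfolding digraph_iso_def
  proof (intro exI conjI)
    \<comment> \<open>Arcs are pairs of vertices, so the isomorphism acts on them
      componentwise.\<close>
    let ?h = "\<lparr> iso_verts = \<phi>, iso_arcs = map_prod \<phi> \<phi>, iso_head = snd, iso_tail = fst \<rparr>"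
    have "inj_on (map_prod \<phi> \<phi>) (parcs F)"
      by (rule inj_on_subset[OF map_prod_inj_on[OF inj inj]])
        (auto dest: F.in_arcsD1 F.in_arcsD2)
    then show "pre_digraph.digraph_isomorphism (with_proj F) ?h"
      unfolding pre_digraph.digraph_isomorphism_def
      using inj F.wf_digraph_axioms by simp
    have "parcs ?H = map_prod \<phi> \<phi> ` parcs F"
    proof
      show "parcs ?H \<subseteq> map_prod \<phi> \<phi> ` parcs F"
        by (auto simp: induced_by_def parcs_hypercube adj image_iff)
      show "map_prod \<phi> \<phi> ` parcs F \<subseteq> parcs ?H"
        using sub F.in_arcsD1 F.in_arcsD2 by (auto simp: induced_by_def parcs_hypercube adj)
    qed
    then show "with_proj ?H = app_iso ?h (with_proj F)"
      by (simp add: app_iso_def with_proj_def induced_by_def)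
  qed
  ultimately show ?thesis
    unfolding induced_copy_def by blast
qed

lemma packs_induced_packing:
  assumes "pair_graph F" "packs F n (cube n) k"
  shows "\<exists>\<P>. induced_packing F (hypercube n) \<P> \<and> card (uncovered (hypercube n) \<P>) \<le> k"
proof -
  obtain \<C> where C: "\<forall>X\<in>\<C>. \<exists>\<phi>. cube_embedding F n \<phi> \<and> X = \<phi> ` pverts F"
    "pairwise disjnt \<C>" "card (cube n - \<Union>\<C>) \<le> k"
    using assms(2) unfolding packs_def by (elim exE conjE)
  let ?P = "induced_by (hypercube n) ` \<C>"
  have verts: "pverts (induced_by G X) = X" for G :: "bool list pair_pre_digraph" and X
    by (simp add: induced_by_def)
  have "induced_copy F (hypercube n) H" if "H \<in> ?P" for H
    using that C(1) cube_embedding_induced_copy[OF assms(1)] by auto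
  moreover have "pairwise (\<lambda>H K. disjnt (pverts H) (pverts K)) ?P"
    using C(2) by (auto simp: pairwise_def verts)
  moreover have "uncovered (hypercube n) ?P = cube n - \<Union>\<C>"
    by (simp add: uncovered_def verts hypercube_def cube_def)
  ultimately show ?thesis
    using C(3) unfolding induced_packing_def by (intro exI[of _ ?P]) simp
qed

theorem theorem4:
  fixes l t :: nat
  assumes "l \<ge> 1" and "t \<ge> 1"
  shows "\<exists>C::real. \<forall>n\<ge>1. \<exists>\<P>.
    induced_packing (cart_power (path_graph l) t) (hypercube n) \<P> \<and>
    real (card (uncovered (hypercube n) \<P>)) \<le> C * real n ^ (t - 1)"
proof -
  obtain K where K: "\<And>n. packs (cart_power (path_graph l) t) n (cube n) (K * (n + 1) ^ (t - 1))"
    using packs_cube[OF assms(1), of "t - 1"] assms(2) by auto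
  have "\<exists>\<P>. induced_packing (cart_power (path_graph l) t) (hypercube n) \<P> \<and>
      real (card (uncovered (hypercube n) \<P>)) \<le> real (K * 2 ^ (t - 1)) * real n ^ (t - 1)"
    if "n \<ge> 1" for n
  proof -
    obtain \<P> where \<P>: "induced_packing (cart_power (path_graph l) t) (hypercube n) \<P>"
      "card (uncovered (hypercube n) \<P>) \<le> K * (n + 1) ^ (t - 1)"
      using packs_induced_packing[OF pair_graph_cart_power[OF pair_graph_path_graph] K] by blast
    \<comment> \<open>For \<open>n >= 1\<close>, \<open>n + 1 <= 2 * n\<close>; the power of 2 goes
      into the constant.\<close>
    have "(n + 1) ^ (t - 1) \<le> (2 * n) ^ (t - 1)"
      using that by (intro power_mono) auto
    then have "K * (n + 1) ^ (t - 1) \<le> K * 2 ^ (t - 1) * n ^ (t - 1)"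
      by (simp add: power_mult_distrib mult.assoc)
    with \<P>(2) have "real (card (uncovered (hypercube n) \<P>)) \<le> real (K * 2 ^ (t - 1) * n ^ (t - 1))"
      by linarith
    with \<P>(1) show ?thesis by auto
  qed
  then show ?thesis by blast
qed

end
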